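(* For real $a,b$ let the positions of four bodies be $q_1=(0,0)$, $q_2=(0,a)$, $q_3=(1,b)$, $q_4=(1,0)$, let $r_{ij}=\|q_i-q_j\|$, and regard $$D=(r_{13}^3-r_{12}^3)(r_{23}^3-r_{34}^3)(r_{24}^3-r_{14}^3)-(r_{12}^3-r_{14}^3)(r_{24}^3-r_{34}^3)(r_{13}^3-r_{23}^3)$$ as a function of $(a,b)$. Let $$\Omega_r=\Big\{(a,b)\in\mathbb{R}^2 : \frac{b^2+1}{2b}\le a<\sqrt{1+b^2},\ \frac{1}{\sqrt3}<b\le 1\Big\}.$$ Then the curve $D=0$ in the region $\Omega_r$ is a graph with respect to the variable $a$: for every $b\in(1/\sqrt3,1]$ there is exactly one $a$ with $(a,b)\in\Omega_r$ and $D(a,b)=0$. In fact, $\partial D/\partial a<0$ at every point of $\Omega_r$ at which $D=0$.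
   Context: Explicitly, $r_{12}=a$, $r_{23}=\sqrt{1+(a-b)^2}$, $r_{14}=1$, $r_{34}=b$, $r_{13}=\sqrt{1+b^2}$, $r_{24}=\sqrt{1+a^2}$. These are the mutual distances of a right trapezoid with vertices $q_1,q_2,q_3,q_4$; the points of $\Omega_r$ are those for which $r_{24}\ge r_{13}>r_{12}\ge r_{23}\ge r_{14}\ge r_{34}$. *)

theory Defs
  imports "HOL-Analysis.Analysis"
begin

definition q :: "real \<Rightarrow> real \<Rightarrow> nat \<Rightarrow> real ^ 2" where
  "q a b i =
    (if i = 1 then vector [0, 0]
     else if i = 2 then vector [0, a]
     else if i = 3 then vector [1, b]
     else vector [1, 0])"

definition r :: "real \<Rightarrow> real \<Rightarrow> nat \<Rightarrow> nat \<Rightarrow> real" where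
  "r a b i j = norm (q a b i - q a b j)"

definition D :: "real \<Rightarrow> real \<Rightarrow> real" where
  "D a b =
     ((r a b 1 3)^3 - (r a b 1 2)^3) * ((r a b 2 3)^3 - (r a b 3 4)^3)
       * ((r a b 2 4)^3 - (r a b 1 4)^3)
   - ((r a b 1 2)^3 - (r a b 1 4)^3) * ((r a b 2 4)^3 - (r a b 3 4)^3)
       * ((r a b 1 3)^3 - (r a b 2 3)^3)"

definition Omega_r :: "(real \<times> real) set" where
  "Omega_r = {(a, b). (b\<^sup>2 + 1) / (2 * b) \<le> a \<and> a < sqrt (1 + b\<^sup>2) \<and>
                      1 / sqrt 3 < b \<and> b \<le> 1}"

text \<open>The bodies sit at a right trapezoid only when \<^term>\<open>a\<close> and \<^term>\<open>b\<close> are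
  nonnegative; in general the two parallel sides have lengths \<^term>\<open>\<bar>a\<bar>\<close> and \<^term>\<open>\<bar>b\<bar>\<close>.\<close>

lemma r_explicit:
  "r a b 1 2 = \<bar>a\<bar>"
  "r a b 2 3 = sqrt (1 + (a - b)\<^sup>2)"
  "r a b 1 4 = 1"
  "r a b 3 4 = \<bar>b\<bar>"
  "r a b 1 3 = sqrt (1 + b\<^sup>2)"
  "r a b 2 4 = sqrt (1 + a\<^sup>2)"
  by (simp_all add: r_def q_def norm_vec_def L2_set_def sum_2)

end

theory Submission
  imports Defs
begin

text \<open>Write \<open>D = A B C - E F G\<close> with \<open>A = r\<^sub>1\<^sub>3\<^sup>3 - r\<^sub>1\<^sub>2\<^sup>3\<close>, \<open>B = r\<^sub>2\<^sub>3\<^sup>3 - r\<^sub>3\<^sub>4\<^sup>3\<close>,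
  \<open>C = r\<^sub>2\<^sub>4\<^sup>3 - r\<^sub>1\<^sub>4\<^sup>3\<close>, \<open>E = r\<^sub>1\<^sub>2\<^sup>3 - r\<^sub>1\<^sub>4\<^sup>3\<close>, \<open>F = r\<^sub>2\<^sub>4\<^sup>3 - r\<^sub>3\<^sub>4\<^sup>3\<close>, \<open>G = r\<^sub>1\<^sub>3\<^sup>3 - r\<^sub>2\<^sub>3\<^sup>3\<close>.
  Where \<open>D = 0\<close>, the inequalities \<open>C \<le> F\<close> and \<open>A \<le> G\<close> force \<open>E \<le> B\<close>, and dividing
  \<open>\<partial>D/\<partial>a\<close> by \<open>A B C = E F G > 0\<close> leaves a difference of logarithmic derivatives whose positive
  terms are dominated one by one. The degenerate zero with \<open>E = 0\<close> is the square \<open>a = b = 1\<close>.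
  For fixed \<open>b < 1\<close>, \<open>D\<close> is positive at the left end of the range of \<open>a\<close>, where
  \<open>r\<^sub>1\<^sub>2 = r\<^sub>2\<^sub>3\<close>, and negative at the right end, where \<open>r\<^sub>1\<^sub>2 = r\<^sub>1\<^sub>3\<close>. So \<open>D\<close> has a zero in
  between, which is unique because \<open>D\<close> decreases through each of its zeros.\<close>

section \<open>Functions decreasing through each of their zeros\<close>

text \<open>Just right of \<open>u\<close> the function is negative; let \<open>z\<close> be its
  first zero after such a point. A negative derivative at \<open>z\<close> makes it positive just
  left of \<open>z\<close>, so there would be a still earlier zero.\<close>

lemma zero_unique_if_deriv_neg_at_zeros:
  fixes f :: "real \<Rightarrow> real"
  assumes "u < v" and cont: "continuous_on {u..v} f" and "f u = 0" "f v = 0"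
    and neg: "\<And>x. x \<in> {u..v} \<Longrightarrow> f x = 0 \<Longrightarrow> \<exists>d. (f has_real_derivative d) (at x) \<and> d < 0"
  shows False
proof -
  obtain d where "(f has_real_derivative d) (at u)" "d < 0"
    using neg[of u] assms(1,3) by auto
  then obtain \<delta> where \<delta>: "\<delta> > 0" "\<And>h. 0 < h \<Longrightarrow> h < \<delta> \<Longrightarrow> f (u + h) < f u"
    using DERIV_neg_dec_right by blast
  define x where "x = u + min (\<delta> / 2) ((v - u) / 2)"
  have x: "u < x" "x < v" "f x < 0"
    using \<delta>(1) \<delta>(2)[of "min (\<delta> / 2) ((v - u) / 2)"] assms(1,3) by (auto simp: x_def min_def field_simps)
  define Z where "Z = {x..v} \<inter> f -` {0}"
  have "closed Z"
    unfolding Z_def using x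
    by (intro continuous_closed_preimage continuous_on_subset[OF cont]) auto
  moreover have "v \<in> Z" "bdd_below Z"
    using x \<open>f v = 0\<close> by (auto simp: Z_def)
  ultimately have "Inf Z \<in> Z"
    using closed_contains_Inf by blast
  define z where "z = Inf Z"
  have z: "x < z" "z \<le> v" "f z = 0"
    using \<open>Inf Z \<in> Z\<close> x(3) by (auto simp: Z_def z_def less_le)
  have least: "z \<le> y" if "y \<in> Z" for y
    using that \<open>bdd_below Z\<close> by (simp add: cInf_lower z_def)
  obtain d' where "(f has_real_derivative d') (at z)" "d' < 0"
    using neg[of z] z x by auto
  then obtain \<epsilon> where \<epsilon>: "\<epsilon> > 0" "\<And>h. 0 < h \<Longrightarrow> h < \<epsilon> \<Longrightarrow> f (z - h) > f z"
    using DERIV_neg_dec_left by blast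
  define y where "y = z - min (\<epsilon> / 2) ((z - x) / 2)"
  have y: "x < y" "y < z" "0 < f y"
    using \<epsilon>(1) \<epsilon>(2)[of "min (\<epsilon> / 2) ((z - x) / 2)"] z by (auto simp: y_def min_def field_simps)
  have "\<exists>w\<ge>x. w \<le> y \<and> f w = 0"
    using x y z by (intro IVT' continuous_on_subset[OF cont]) auto
  then obtain w where "x \<le> w" "w \<le> y" "f w = 0"
    by blast
  then show False
    using least[of w] y z by (auto simp: Z_def)
qed

section \<open>The partial derivative of \<open>D\<close> in \<open>a\<close>\<close>

lemma has_real_derivative_sqrt_cubed:
  "((\<lambda>x. sqrt (1 + (x - c)\<^sup>2) ^ 3) has_real_derivative 3 * sqrt (1 + (a - c)\<^sup>2) * (a - c)) (at a)"
proof -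
  have pos: "1 + (a - c)\<^sup>2 > 0"
    by (simp add: add_pos_nonneg)
  then show ?thesis
    by (auto intro!: derivative_eq_intros simp: field_simps power2_eq_square)
qed

lemma D_explicit:
  assumes "0 \<le> a" "0 \<le> b"
  shows "D a b =
    (sqrt (1 + b\<^sup>2) ^ 3 - a ^ 3) * (sqrt (1 + (a - b)\<^sup>2) ^ 3 - b ^ 3) * (sqrt (1 + a\<^sup>2) ^ 3 - 1)
    - (a ^ 3 - 1) * (sqrt (1 + a\<^sup>2) ^ 3 - b ^ 3) * (sqrt (1 + b\<^sup>2) ^ 3 - sqrt (1 + (a - b)\<^sup>2) ^ 3)"
  unfolding D_def r_explicit using assms by simp

lemma D_has_derivative:
  fixes a b :: real
  assumes "0 < a" "0 \<le> b"
  defines "p \<equiv> sqrt (1 + b\<^sup>2)" and "s \<equiv> sqrt (1 + (a - b)\<^sup>2)" and "t \<equiv> sqrt (1 + a\<^sup>2)"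
  shows "((\<lambda>x. D x b) has_real_derivative
    3 * ((p ^ 3 - a ^ 3) * (s * (a - b)) * (t ^ 3 - 1) + (p ^ 3 - a ^ 3) * (s ^ 3 - b ^ 3) * (t * a)
      - a\<^sup>2 * (s ^ 3 - b ^ 3) * (t ^ 3 - 1)
      - (a\<^sup>2 * (t ^ 3 - b ^ 3) * (p ^ 3 - s ^ 3) + (a ^ 3 - 1) * (t * a) * (p ^ 3 - s ^ 3)
      - (a ^ 3 - 1) * (t ^ 3 - b ^ 3) * (s * (a - b))))) (at a)"
    (is "(_ has_real_derivative ?d) _")
\<comment> \<open>The explicit form replaces \<open>\<bar>a\<bar>\<close> by \<open>a\<close>, so it
  is differentiated in place of \<open>D\<close> on the open half-line of positive reals.\<close>
proof (rule has_field_derivative_transform_within_open)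
  have dt: "((\<lambda>x. sqrt (1 + x\<^sup>2) ^ 3) has_real_derivative 3 * t * a) (at a)"
    using has_real_derivative_sqrt_cubed[of 0 a] by (simp add: t_def)
  have ds: "((\<lambda>x. sqrt (1 + (x - b)\<^sup>2) ^ 3) has_real_derivative 3 * s * (a - b)) (at a)"
    using has_real_derivative_sqrt_cubed[of b a] by (simp add: s_def)
  show "((\<lambda>x. (p ^ 3 - x ^ 3) * (sqrt (1 + (x - b)\<^sup>2) ^ 3 - b ^ 3) * (sqrt (1 + x\<^sup>2) ^ 3 - 1)
      - (x ^ 3 - 1) * (sqrt (1 + x\<^sup>2) ^ 3 - b ^ 3) * (p ^ 3 - sqrt (1 + (x - b)\<^sup>2) ^ 3))
    has_real_derivative ?d) (at a)"
    by (rule derivative_eq_intros refl dt ds)+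
      (unfold s_def[symmetric] t_def[symmetric], simp add: algebra_simps power2_eq_square)
  show "open {0 :: real<..}" "a \<in> {0<..}"
    using assms by auto
qed (use assms in \<open>simp add: D_explicit\<close>)

section \<open>The sign of the derivative at zeros in \<open>Omega_r\<close>\<close>

text \<open>The lower bound on \<open>a\<close> amounts to
  \<open>1 + b\<^sup>2 \<le> 2 * a * b\<close>; together with
  \<open>2 * b \<le> 1 + b\<^sup>2\<close> it yields \<open>1 \<le> a\<close>.\<close>

lemma Omega_r_bounds:
  assumes "(a, b) \<in> Omega_r"
  shows "1 / 2 < b" "b \<le> 1" "1 \<le> a" "1 + b\<^sup>2 \<le> 2 * a * b" "a < sqrt (1 + b\<^sup>2)"
proof -
  have b: "1 / sqrt 3 < b" "b \<le> 1" and a: "(b\<^sup>2 + 1) / (2 * b) \<le> a" "a < sqrt (1 + b\<^sup>2)"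
    using assms by (auto simp: Omega_r_def)
  have "sqrt 3 < 2"
    by (rule real_less_lsqrt) auto
  then have "1 / 2 < 1 / sqrt 3"
    by (simp add: field_simps)
  with b show b2: "1 / 2 < b" and "b \<le> 1"
    by linarith+
  then show ab: "1 + b\<^sup>2 \<le> 2 * a * b"
    using a by (simp add: field_simps)
  have "0 \<le> (1 - b)\<^sup>2"
    by simp
  then have "1 * b \<le> a * b"
    using ab by (simp add: power2_eq_square algebra_simps)
  then show "1 \<le> a"
    using b2 by simp
  show "a < sqrt (1 + b\<^sup>2)"
    by fact
qed

lemma D_deriv_neg:
  assumes O: "(a, b) \<in> Omega_r" and D0: "D a b = 0"
  shows "\<exists>d. ((\<lambda>x. D x b) has_real_derivative d) (at a) \<and> d < 0"
proof -
  note bd = Omega_r_bounds[OF O]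
  define p s t where "p = sqrt (1 + b\<^sup>2)" and "s = sqrt (1 + (a - b)\<^sup>2)" and "t = sqrt (1 + a\<^sup>2)"
  define A B C E F G where
    "A = p ^ 3 - a ^ 3" and "B = s ^ 3 - b ^ 3" and "C = t ^ 3 - 1" and
    "E = a ^ 3 - 1" and "F = t ^ 3 - b ^ 3" and "G = p ^ 3 - s ^ 3"
  define d where "d = A * (s * (a - b)) * C + A * B * (t * a) - a\<^sup>2 * B * C
    - (a\<^sup>2 * F * G + E * (t * a) * G - E * F * (s * (a - b)))"
  have deriv: "((\<lambda>x. D x b) has_real_derivative 3 * d) (at a)"
    using D_has_derivative[of a b] bd
    by (simp add: d_def A_def B_def C_def E_def F_def G_def p_def s_def t_def)
  have PQ: "A * B * C = E * F * G"
    using D0 bd by (simp add: D_explicit A_def B_def C_def E_def F_def G_def p_def s_def t_def)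
  \<comment> \<open>After squaring, this is \<open>1 + b\<^sup>2 \<le> 2 * a * b\<close>.\<close>
  have s_le: "s \<le> a"
    unfolding s_def using bd by (intro real_le_lsqrt) (auto simp: power2_eq_square algebra_simps)
  have s1: "1 \<le> s" and ta: "a < t"
    using bd by (auto simp: s_def t_def intro: real_less_rsqrt)
  have ap: "a < p"
    using bd by (simp add: p_def)
  have t2: "2 \<le> t\<^sup>2"
    using bd by (simp add: t_def)
  have A: "A > 0" and EC: "E < C" and E: "E \<ge> 0" and AG: "A \<le> G"
    using ap bd ta s_le s1 power_strict_mono[of a p 3] power_strict_mono[of a t 3]
      power_mono[of 1 a 3] power_mono[of s a 3]
    by (auto simp: A_def E_def C_def G_def)
  have FC: "F = C + (1 - b ^ 3)" and b3: "b ^ 3 \<le> 1"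
    using bd power_mono[of b 1 3] by (auto simp: F_def C_def)
  have CF: "C \<le> F" and C: "C > 0" and G: "G > 0"
    using FC b3 EC E A AG by auto
  have F: "F > 0"
    using C CF by simp
  have "d < 0"
  \<comment> \<open>If \<open>E = 0\<close>, division by \<open>A * B * C\<close> is impossible, but
    then also \<open>B = 0\<close> and \<open>a = b\<close>, so \<open>d\<close> collapses to
    \<open>- F * G\<close>.\<close>
  proof (cases "E = 0")
    case True
    then have "a = 1"
      using bd one_less_power[of a 3] by (force simp: E_def)
    then have "(1 - b)\<^sup>2 \<le> 0"
      using bd by (simp add: power2_eq_square algebra_simps)
    then have "b = 1"
      by simp
    have "B = 0"
      using \<open>a = 1\<close> \<open>b = 1\<close> by (simp add: B_def s_def)
    then show ?thesis
      using True F G \<open>a = 1\<close> \<open>b = 1\<close> by (simp add: d_def)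
  next
    case False
    then have E: "E > 0"
      using E by simp
    have EB: "E \<le> B"
    proof (rule ccontr)
      assume "\<not> E \<le> B"
      then have "A * B * C < A * E * C"
        using A C by simp
      also have "\<dots> = E * (C * A)"
        by simp
      also have "\<dots> \<le> E * (F * G)"
        using E CF AG C A F by (intro mult_left_mono mult_mono) auto
      finally show False
        using PQ by simp
    qed
    then have B: "B > 0"
      using E by simp
    have sab: "0 \<le> s * (a - b)" "s * (a - b) \<le> a * (a - b)"
      using s_le s1 bd by (auto intro: mult_right_mono)
    have ab: "0 < a * b"
      using bd by simp
    have "s * (a - b) / G \<le> a * (a - b) / A"
      using sab A AG by (intro frac_le) auto
    also have "\<dots> < a\<^sup>2 / A"
      using A ab by (intro divide_strict_right_mono) (auto simp: power2_eq_square algebra_simps)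
    finally have I1: "s * (a - b) / G < a\<^sup>2 / A" .
    have I2: "s * (a - b) / B \<le> a * (a - b) / E"
      using sab E EB by (intro frac_le) auto
    \<comment> \<open>Here \<open>2 * b > 1\<close> and \<open>t\<^sup>2 \<ge> 2\<close> give
      \<open>t < 2 * b * t \<le> b * t ^ 3\<close>, while \<open>b \<le> t\<close> gives
      \<open>b ^ 4 \<le> b ^ 3 * t\<close>.\<close>
    have tF: "t * (1 - b ^ 3) < b * F"
    proof -
      have "b ^ 3 * b \<le> b ^ 3 * t"
        using bd ta by (intro mult_left_mono) auto
      moreover have "b * t * 2 \<le> b * t * t\<^sup>2"
        using bd ta t2 by (intro mult_left_mono) auto
      moreover have "t * 1 < t * (2 * b)"
        using bd ta by (intro mult_strict_left_mono) auto
      ultimately show ?thesis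
        by (simp add: F_def algebra_simps power2_eq_square power3_eq_cube)
    qed
    have "t * a / C - t * a / F = a * (t * (F - C)) / (C * F)"
      using C F by (simp add: field_simps)
    also have "\<dots> = a * (t * (1 - b ^ 3)) / (C * F)"
      by (simp add: FC)
    also have "\<dots> \<le> a * (b * F) / (C * F)"
      using tF C F bd by (intro divide_right_mono mult_left_mono) auto
    also have "\<dots> = a * b / C"
      using F by simp
    also have "\<dots> \<le> a * b / E"
      using ab E EC by (intro divide_left_mono) auto
    finally have I3: "t * a / C - t * a / F \<le> a * b / E" .
    \<comment> \<open>The bounds in \<open>I2\<close> and \<open>I3\<close> add up to exactly the
      negative term \<open>a\<^sup>2 / E\<close>; strictness comes from \<open>I1\<close>.\<close>
    have "a * (a - b) / E + a * b / E = a\<^sup>2 / E"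
      by (simp add: add_divide_distrib[symmetric] power2_eq_square algebra_simps)
    with I1 I2 I3 have neg: "s * (a - b) / B + t * a / C - a\<^sup>2 / A
        - (a\<^sup>2 / E + t * a / F - s * (a - b) / G) < 0"
      by linarith
    have "d = (A * B * C) * (s * (a - b) / B + t * a / C - a\<^sup>2 / A)
        - (E * F * G) * (a\<^sup>2 / E + t * a / F - s * (a - b) / G)"
      using A B C E F G by (simp add: d_def field_simps)
    also have "\<dots> = (A * B * C) * (s * (a - b) / B + t * a / C - a\<^sup>2 / A
        - (a\<^sup>2 / E + t * a / F - s * (a - b) / G))"
      by (simp only: PQ right_diff_distrib)
    also have "\<dots> < 0"
      using A B C neg by (intro mult_pos_neg) auto
    finally show ?thesis .
  qed
  then show ?thesis
    using deriv by (intro exI[of _ "3 * d"]) auto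
qed

section \<open>Endpoint signs, existence and uniqueness\<close>

lemma continuous_on_D:
  assumes "0 < u" "0 \<le> b"
  shows "continuous_on {u..v} (\<lambda>x. D x b)"
  using assms by (intro continuous_at_imp_continuous_on ballI DERIV_isCont[OF D_has_derivative]) auto

text \<open>Since \<open>r\<^sub>2\<^sub>3 = a\<close> here, \<open>A = G\<close> factors out and
  the remaining difference of products factors again. For \<open>b = 1\<close> the value is 0, hence
  no strict sign.\<close>

lemma D_left_endpoint_nonneg:
  assumes "0 < a" "0 \<le> b" "b \<le> 1" "a \<le> sqrt (1 + b\<^sup>2)" "1 + b\<^sup>2 = 2 * a * b"
  shows "0 \<le> D a b"
proof -
  have "1 + (a - b)\<^sup>2 = a\<^sup>2"
    using assms(5) by (simp add: power2_eq_square algebra_simps)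
  then have s: "sqrt (1 + (a - b)\<^sup>2) = a"
    using assms by simp
  have "D a b = (sqrt (1 + b\<^sup>2) ^ 3 - a ^ 3) * ((1 - b ^ 3) * (sqrt (1 + a\<^sup>2) ^ 3 - a ^ 3))"
    using assms by (simp add: D_explicit s algebra_simps)
  moreover have "a ^ 3 \<le> sqrt (1 + b\<^sup>2) ^ 3" "b ^ 3 \<le> 1 ^ 3" "a ^ 3 \<le> sqrt (1 + a\<^sup>2) ^ 3"
    using assms by (intro power_mono; simp add: real_le_rsqrt)+
  ultimately show ?thesis
    by simp
qed

text \<open>At \<open>a = r\<^sub>1\<^sub>3\<close> the factor \<open>A\<close> vanishes, leaving
  \<open>- E * F * G\<close>. The condition \<open>1 < 3 * b\<^sup>2\<close> means
  \<open>r\<^sub>1\<^sub>3 < 2 * b\<close>, which makes \<open>G\<close> positive.\<close>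

lemma D_right_endpoint_neg:
  assumes "0 < b" "b \<le> 1" "1 < 3 * b\<^sup>2"
  shows "1 + b\<^sup>2 < 2 * sqrt (1 + b\<^sup>2) * b" "D (sqrt (1 + b\<^sup>2)) b < 0"
proof -
  define p where "p = sqrt (1 + b\<^sup>2)"
  have p2: "p\<^sup>2 = 1 + b\<^sup>2"
    by (simp add: p_def)
  have p: "1 < p"
    using assms by (simp add: p_def)
  have "p < 2 * b"
    unfolding p_def using assms by (intro real_less_lsqrt) (auto simp: power_mult_distrib)
  then have "p * p < p * (2 * b)"
    using p by (intro mult_strict_left_mono) auto
  then have *: "1 + b\<^sup>2 < 2 * p * b"
    using p2 by (simp add: power2_eq_square algebra_simps)
  then show "1 + b\<^sup>2 < 2 * sqrt (1 + b\<^sup>2) * b"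
    by (simp add: p_def)
  have "sqrt (1 + (p - b)\<^sup>2) < p"
    using p * by (intro real_less_lsqrt) (auto simp: power2_eq_square algebra_simps)
  then have "sqrt (1 + (p - b)\<^sup>2) ^ 3 < p ^ 3"
    by (intro power_strict_mono) auto
  moreover have "1 ^ 3 < p ^ 3"
    using p by (intro power_strict_mono) auto
  moreover have "b ^ 3 < sqrt (1 + p\<^sup>2) ^ 3"
    using assms p by (intro power_strict_mono real_less_rsqrt) (auto simp: p2)
  ultimately have "0 < (p ^ 3 - 1) * (sqrt (1 + p\<^sup>2) ^ 3 - b ^ 3)
      * (p ^ 3 - sqrt (1 + (p - b)\<^sup>2) ^ 3)"
    by simp
  then have "D p b < 0"
    using p assms by (simp add: D_explicit flip: p_def)
  then show "D (sqrt (1 + b\<^sup>2)) b < 0"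
    by (simp add: p_def)
qed

lemma D_zero_exists:
  assumes b: "1 / sqrt 3 < b" "b \<le> 1"
  shows "\<exists>a. (a, b) \<in> Omega_r \<and> D a b = 0"
proof -
  have b0: "0 < b"
    using b(1) by (rule less_trans[rotated]) simp
  have "(1 / sqrt 3)\<^sup>2 < b\<^sup>2"
    using b by (intro power_strict_mono) auto
  then have b3: "1 < 3 * b\<^sup>2"
    by (simp add: power_divide)
  define l p where "l = (b\<^sup>2 + 1) / (2 * b)" and "p = sqrt (1 + b\<^sup>2)"
  have l0: "0 < l"
    using b0 by (simp add: l_def add_nonneg_pos)
  have lb: "1 + b\<^sup>2 = 2 * l * b"
    using b0 by (simp add: l_def)
  note right = D_right_endpoint_neg[OF b0 b(2) b3, folded p_def]
  have "l < p"
    using right(1) b0 lb by simp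
  then have "0 \<le> D l b"
    using D_left_endpoint_nonneg l0 b0 b lb by (simp add: p_def)
  then have "\<exists>a\<ge>l. a \<le> p \<and> D a b = 0"
    using right(2) \<open>l < p\<close> continuous_on_D[OF l0, of b p] b0
    by (intro IVT2') auto
  then obtain a where a: "l \<le> a" "a \<le> p" "D a b = 0"
    by blast
  \<comment> \<open>The right end does not belong to \<open>Omega_r\<close>, so a zero there has to
    be excluded.\<close>
  then have "a \<noteq> p"
    using right(2) by auto
  then show ?thesis
    using a b by (auto simp: Omega_r_def l_def p_def)
qed

lemma D_zero_unique:
  assumes "(a, b) \<in> Omega_r" "D a b = 0" "(a', b) \<in> Omega_r" "D a' b = 0"
  shows "a = a'"
proof -
  have False if "u < v" "(u, b) \<in> Omega_r" "D u b = 0" "(v, b) \<in> Omega_r" "D v b = 0" for u v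
  proof (rule zero_unique_if_deriv_neg_at_zeros[of u v "\<lambda>x. D x b"])
    show "continuous_on {u..v} (\<lambda>x. D x b)"
      using Omega_r_bounds[OF that(2)] by (intro continuous_on_D) auto
    fix x assume "x \<in> {u..v}" "D x b = 0"
    \<comment> \<open>For fixed \<open>b\<close> the slice of \<open>Omega_r\<close> is an
      interval.\<close>
    moreover from this have "(x, b) \<in> Omega_r"
      using that(2,4) by (auto simp: Omega_r_def)
    ultimately show "\<exists>d. ((\<lambda>x. D x b) has_real_derivative d) (at x) \<and> d < 0"
      by (intro D_deriv_neg)
  qed (use that in auto)
  then show ?thesis
    using assms by (meson linorder_neqE)
qed

theorem theorem9:
  shows "(\<forall>b. 1 / sqrt 3 < b \<and> b \<le> 1 \<longrightarrow> (\<exists>!a. (a, b) \<in> Omega_r \<and> D a b = 0)) \<and>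
         (\<forall>a b. (a, b) \<in> Omega_r \<and> D a b = 0 \<longrightarrow>
            (\<exists>d. ((\<lambda>x. D x b) has_real_derivative d) (at a) \<and> d < 0))"
  using D_zero_exists D_zero_unique D_deriv_neg by blast

end
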